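(* Let $m\ge 3$ be an integer. Then the Fibonacci lattice $\mathcal F_m=\big\{\big(\tfrac{k}{F_m},\{\tfrac{kF_{m-2}}{F_m}\}\big): k\in\{0,1,\dots,F_m-1\}\big\}$ satisfies $$\operatorname{disp}(\mathcal F_m)=\frac{2}{F_m},$$ where $\operatorname{disp}$ denotes the periodic dispersion on the two-dimensional torus.
   Context: Fibonacci numbers: $F_1=F_2=1$ and $F_{m+2}=F_m+F_{m+1}$ for $m\ge 1$. For real $\alpha$, $\{\alpha\}$ is its fractional part. The two-dimensional torus is identified with $[0,1]^2$ (opposite sides identified). For $a,b\in[0,1]$ let $I(a,b)=[a,b]$ if $a\le b$, and $I(a,b)=[0,b]\cup[a,1]$ if $a>b$ (a wrapped-around interval). For $x=(x_1,x_2),y=(y_1,y_2)\in[0,1]^2$ the periodic rectangle is $B(x,y)=I(x_1,y_1)\times I(x_2,y_2)$. For a finite point set $\mathcal P\subset[0,1]^2$, the (periodic) dispersion $\operatorname{disp}(\mathcal P)$ is the area of the largest periodic rectangle $B(x,y)$ containing no point of $\mathcal P$ in its interior (interior taken in the torus), i.e. the supremum of the areas of all such rectangles. *)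

theory Defs
  imports "HOL-Analysis.Analysis" "HOL-Number_Theory.Fib"
begin

definition unit_square :: "(real \<times> real) set" where
  "unit_square = {0..1} \<times> {0..1}"

text \<open>
  The torus is modelled as the product of two unit circles in the complex plane, with the
  topology induced from the ambient space. The map below is the quotient map from the unit
  square: it identifies precisely the opposite sides.
\<close>

definition torus :: "(complex \<times> complex) topology" where
  "torus = top_of_set (sphere 0 1 \<times> sphere 0 1)"

definition to_torus :: "real \<times> real \<Rightarrow> complex \<times> complex" where
  "to_torus p = (cis (2 * pi * fst p), cis (2 * pi * snd p))"

definition periodic_interval :: "real \<Rightarrow> real \<Rightarrow> real set" where
  "periodic_interval a b = (if a \<le> b then {a..b} else {0..b} \<union> {a..1})"

definition periodic_rectangle :: "real \<times> real \<Rightarrow> real \<times> real \<Rightarrow> (real \<times> real) set" where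
  "periodic_rectangle x y =
     periodic_interval (fst x) (fst y) \<times> periodic_interval (snd x) (snd y)"

text \<open>
  The interior is taken in the torus, not in the plane or in the square: a rectangle meeting
  only one of two identified sides has no interior point on that side, whereas a wrapped-around
  rectangle may have interior points on the sides of the square.
\<close>

definition empty_rectangle :: "(real \<times> real) set \<Rightarrow> (real \<times> real) set \<Rightarrow> bool" where
  "empty_rectangle P B \<longleftrightarrow> to_torus ` P \<inter> (torus interior_of (to_torus ` B)) = {}"

text \<open>
  The set of areas is bounded by 1, and it is nonempty since degenerate rectangles have empty
  interior, so the real supremum is meaningful. It need not be attained.
\<close>

definition disp :: "(real \<times> real) set \<Rightarrow> real" where
  "disp P = Sup {measure lborel (periodic_rectangle x y) | x y.
     x \<in> unit_square \<and> y \<in> unit_square \<and> empty_rectangle P (periodic_rectangle x y)}"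

definition fibonacci_lattice :: "nat \<Rightarrow> (real \<times> real) set" where
  "fibonacci_lattice m =
     (\<lambda>k. (real k / real (fib m), frac (real (k * fib (m - 2)) / real (fib m)))) ` {0..fib m - 1}"

end

theory Submission
  imports Defs
begin

text \<open>
  Scaled by \<open>F\<^sub>m\<close>, the point set becomes the lattice of all \<open>(i, k)\<close> with
  \<open>k \<equiv> i F\<^sub>m\<^sub>-\<^sub>2\<close> modulo \<open>F\<^sub>m\<close>. It contains the vectors \<open>(F\<^sub>j, (-1)\<^sup>j F\<^sub>m\<^sub>-\<^sub>j)\<close>, and two
  consecutive ones point into adjacent quadrants. In a vertical strip of width greater than
  \<open>F\<^sub>j + F\<^sub>j\<^sub>+\<^sub>1 = F\<^sub>j\<^sub>+\<^sub>2\<close> these two vectors allow one to climb from any lattice point through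
  lattice points of the strip in steps of height at most \<open>F\<^sub>m\<^sub>-\<^sub>j\<close>. So an empty box of width
  \<open>F\<^sub>i < s \<le> F\<^sub>i\<^sub>+\<^sub>1\<close> has height at most \<open>F\<^sub>m\<^sub>-\<^sub>i\<^sub>+\<^sub>2\<close>, hence area at most
  \<open>F\<^sub>i\<^sub>+\<^sub>1 F\<^sub>m\<^sub>-\<^sub>i\<^sub>+\<^sub>2 \<le> 2 F\<^sub>m\<close>.
\<close>

section \<open>Lattice points in boxes of the plane\<close>

definition integer_lattice :: "int \<Rightarrow> int \<Rightarrow> (int \<times> int) set" where
  "integer_lattice n q = {(i, j). n dvd j - i * q}"

lemma integer_lattice_add:
  assumes "(i, j) \<in> integer_lattice n q" "(i', j') \<in> integer_lattice n q"
  shows "(i + i', j + j') \<in> integer_lattice n q"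
  using dvd_add[of n "j - i * q" "j' - i' * q"] assms
  by (simp add: integer_lattice_def algebra_simps)

lemma integer_lattice_diff:
  assumes "(i, j) \<in> integer_lattice n q" "(i', j') \<in> integer_lattice n q"
  shows "(i - i', j - j') \<in> integer_lattice n q"
  using dvd_diff[of n "j - i * q" "j' - i' * q"] assms
  by (simp add: integer_lattice_def algebra_simps)

text \<open>Take a highest lattice point of the strip at height at most \<open>Y\<close>. A step up
  from it that stays in the strip must, by maximality, land above \<open>Y\<close>, and it lands
  below \<open>Y + t\<close> because both steps are shorter than \<open>t\<close>.\<close>

lemma box_meets_integer_lattice:
  fixes X Y s t :: real
  assumes n: "n > 0"
    and u: "(a, b) \<in> integer_lattice n q"
    and v: "(c, - d) \<in> integer_lattice n q"
    and pos: "a > 0" "b > 0" "c > 0" "d > 0"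
    and s: "of_int (a + c) < s"
    and t: "of_int b < t" "of_int d < t"
  shows "\<exists>i j. (i, j) \<in> integer_lattice n q \<and> X < of_int i \<and> of_int i < X + s \<and>
           Y < of_int j \<and> of_int j < Y + t"
proof -
  define P where "P = (\<lambda>(i, j). (i, j) \<in> integer_lattice n q \<and> X < of_int i \<and> of_int i < X + s \<and>
    of_int j \<le> Y)"
  define i0 where "i0 = \<lfloor>X\<rfloor> + 1"
  \<comment> \<open>Since \<open>n \<ge> 1\<close>, going down by \<open>n * k\<close> in the column
    \<open>i0\<close> reaches height at most \<open>Y\<close>, so the strip has a candidate.\<close>
  define k where "k = \<bar>i0 * q - \<lfloor>Y\<rfloor>\<bar>"
  have "k \<le> n * k"
    using n mult_right_mono[of 1 n k] by (simp add: k_def)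
  then have "i0 * q - n * k \<le> \<lfloor>Y\<rfloor>"
    by (simp add: k_def)
  then have "of_int (i0 * q - n * k) \<le> Y"
    by (simp only: le_floor_iff)
  moreover have "X < of_int i0" "of_int i0 < X + s"
    using s pos unfolding i0_def by linarith+
  ultimately have "P (i0, i0 * q - n * k)"
    by (simp add: P_def integer_lattice_def)
  then obtain p where p: "P p" "\<And>p'. P p' \<Longrightarrow> nat (\<lfloor>Y\<rfloor> - snd p) \<le> nat (\<lfloor>Y\<rfloor> - snd p')"
    using ex_has_least_nat[of P _ "\<lambda>p. nat (\<lfloor>Y\<rfloor> - snd p)"] by blast
  obtain i j where ij: "p = (i, j)" by fastforce
  have maximal: "j' \<le> j" if "P (i', j')" for i' j'
  proof -
    have "j' \<le> \<lfloor>Y\<rfloor>" using that by (simp add: P_def le_floor_iff)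
    then show ?thesis using p(2)[OF that] ij by (simp add: nat_le_eq_zle)
  qed
  have Pij: "(i, j) \<in> integer_lattice n q" "X < of_int i" "of_int i < X + s" "of_int j \<le> Y"
    using p(1) by (auto simp: P_def ij)
  text \<open>The strip is so wide that one of the two upward steps \<open>(a, b)\<close> and \<open>(- c, d)\<close> stays inside.\<close>
  show ?thesis
  proof (cases "of_int (i + a) < X + s")
    case True
    have m: "(i + a, j + b) \<in> integer_lattice n q"
      by (rule integer_lattice_add[OF Pij(1) u])
    have "\<not> of_int (j + b) \<le> Y"
      using maximal[of "i + a" "j + b"] m True Pij pos by (auto simp: P_def)
    then show ?thesis
      using m True Pij pos t by (intro exI[of _ "i + a"] exI[of _ "j + b"]) auto
  next
    case False
    have m: "(i - c, j + d) \<in> integer_lattice n q"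
      using integer_lattice_diff[OF Pij(1) v] by simp
    have X: "X < of_int (i - c)"
      using False s by simp
    have "\<not> of_int (j + d) \<le> Y"
      using maximal[of "i - c" "j + d"] m X Pij pos by (auto simp: P_def)
    then show ?thesis
      using m X Pij pos t by (intro exI[of _ "i - c"] exI[of _ "j + d"]) auto
  qed
qed

text \<open>The alternating sign makes each vector the sum of its two predecessors. The recursion
  starts from \<open>(0, fib m)\<close> and \<open>(1, - fib (m - 1))\<close>, where
  \<open>- fib (m - 1)\<close> is congruent to \<open>fib (m - 2)\<close>.\<close>

lemma fib_vector_in_integer_lattice:
  assumes "m \<ge> 2" "j \<le> m"
  shows "(int (fib j), (-1) ^ j * int (fib (m - j))) \<in> integer_lattice (fib m) (fib (m - 2))"
  using \<open>j \<le> m\<close>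
proof (induction j rule: fib.induct)
  case 1
  then show ?case by (simp add: integer_lattice_def)
next
  case 2
  obtain l where "m = Suc (Suc l)"
    using assms(1) by (metis add_2_eq_Suc le_Suc_ex)
  then show ?case
    using dvd_minus_iff[of "int (fib m)" "int (fib m)"] by (simp add: integer_lattice_def)
next
  case (3 j)
  obtain l where l: "m = Suc (Suc (j + l))"
    using 3(3) by (metis add_Suc le_Suc_ex)
  have "m - j = Suc (Suc l)" "m - Suc j = Suc l" "m - Suc (Suc j) = l"
    using l by auto
  then show ?case
    using integer_lattice_add[OF 3(1) 3(2)] 3(3) by (simp add: algebra_simps)
qed

lemma box_meets_fib_lattice:
  fixes X Y s t :: real
  assumes j: "0 < j" "j + 2 \<le> m"
    and s: "real (fib (j + 2)) < s"
    and t: "real (fib (m - j)) < t"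
  shows "\<exists>i k. (i, k) \<in> integer_lattice (fib m) (fib (m - 2)) \<and> X < of_int i \<and> of_int i < X + s \<and>
           Y < of_int k \<and> of_int k < Y + t"
proof -
  have pos: "fib m > 0" "fib j > 0" "fib (Suc j) > 0" "fib (m - j) > 0" "fib (m - Suc j) > 0"
    using j by (auto intro!: fib_neq_0_nat)
  have "fib (m - Suc j) \<le> fib (m - j)"
    by (intro fib_mono) auto
  then have t': "real (fib (m - Suc j)) < t"
    using t by linarith
  have u: "(int (fib j), (-1) ^ j * int (fib (m - j))) \<in> integer_lattice (fib m) (fib (m - 2))"
    and v: "(int (fib (Suc j)), (-1) ^ Suc j * int (fib (m - Suc j)))
      \<in> integer_lattice (fib m) (fib (m - 2))"
    using j by (auto intro!: fib_vector_in_integer_lattice simp del: power_Suc fib.simps)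
  show ?thesis
  \<comment> \<open>The parity of \<open>j\<close> decides which of the two vectors points
    upwards.\<close>
  proof (cases "even j")
    case True
    then show ?thesis
      using box_meets_integer_lattice[of "fib m" "fib j" "fib (m - j)" "fib (m - 2)" "fib (Suc j)"
          "fib (m - Suc j)" s t X Y] u v pos s t t'
      by simp
  next
    case False
    then show ?thesis
      using box_meets_integer_lattice[of "fib m" "fib (Suc j)" "fib (m - Suc j)" "fib (m - 2)"
          "fib j" "fib (m - j)" s t X Y] u v pos s t t'
      by simp
  qed
qed

section \<open>Area of empty boxes\<close>

text \<open>Expanding the product gives \<open>fib (p + r + 2)\<close> plus cross terms. These are
  at most \<open>fib (p + r + 2)\<close> by the rearrangement inequality, the difference being the
  product \<open>x * y\<close> of two increments.\<close>

lemma fib_mult_le_twice_fib: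
  "fib (p + 3) * fib (r + 2) \<le> 2 * fib (p + r + 2)"
proof -
  have *: "fib (p + r + 2) = fib (Suc r) * fib (p + 2) + fib r * fib (p + 1)"
    using fib_add[of "Suc p" r] by (simp add: ac_simps)
  have "fib (p + 3) * fib (r + 2) = (fib (p + 2) + fib (p + 1)) * (fib (r + 1) + fib r)"
    by (simp add: eval_nat_numeral)
  also have "\<dots> = fib (p + r + 2) + (fib (p + 1) * fib (r + 1) + fib (p + 2) * fib r)"
    unfolding * by (simp add: algebra_simps del: fib.simps)
  also have "fib (p + 1) * fib (r + 1) + fib (p + 2) * fib r \<le> fib (p + r + 2)"
  proof -
    obtain x where x: "fib (p + 2) = fib (p + 1) + x"
      using fib_plus_2 by blast
    obtain y where y: "fib (r + 1) = fib r + y"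
      using fib_Suc_mono[of r] by (metis Suc_eq_plus1 le_Suc_ex)
    show ?thesis
      unfolding * x using y by (simp add: algebra_simps del: fib.simps)
  qed
  finally show ?thesis by simp
qed

lemma empty_box_area_le:
  fixes X Y s t :: real
  assumes m: "m \<ge> 3"
    and s: "0 \<le> s" "s \<le> fib m" and t: "0 \<le> t" "t \<le> fib m"
    and empty: "\<And>i k. (i, k) \<in> integer_lattice (fib m) (fib (m - 2)) \<Longrightarrow>
      X < of_int i \<Longrightarrow> of_int i < X + s \<Longrightarrow> Y < of_int k \<Longrightarrow> of_int k < Y + t \<Longrightarrow> False"
  shows "s * t \<le> 2 * real (fib m)"
\<comment> \<open>Narrow boxes are settled by \<open>t \<le> fib m\<close>. For \<open>s > 2\<close>
  the least \<open>k\<close> is at least 4, so that the index \<open>k - 3\<close> used below is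
  positive.\<close>
proof (cases "s \<le> 2")
  case True
  then show ?thesis
    using mult_mono[of s 2 t "fib m"] s t by simp
next
  case False
  define k where "k = (LEAST k. s \<le> fib k)"
  have k: "s \<le> fib k"
    unfolding k_def by (rule LeastI[of _ m]) (rule s)
  have "k \<le> m"
    unfolding k_def by (rule Least_le) (rule s)
  have less: "fib i < s" if "i < k" for i
    using not_less_Least[of i "\<lambda>k. s \<le> fib k"] that by (simp add: k_def)
  have "fib 3 = 2" by (simp add: eval_nat_numeral)
  then have "\<not> k \<le> 3"
    using fib_mono[of k 3] False k by linarith
  then obtain p where p: "k = p + 4"
    using nat_le_iff_add[of 4 k] by (auto simp: add.commute)
  obtain r where r: "m = p + 4 + r"
    using \<open>k \<le> m\<close> p le_Suc_ex by blast
  have "t \<le> fib (r + 3)"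
  proof (rule ccontr)
    assume "\<not> t \<le> fib (r + 3)"
    then show False
      using box_meets_fib_lattice[of "p + 1" m s t X Y] less[of "p + 3"] empty
      by (auto simp: p r eval_nat_numeral simp del: fib.simps)
  qed
  then have "s * t \<le> real (fib k * fib (r + 3))"
    using mult_mono[OF k] t by simp
  also have "fib k * fib (r + 3) \<le> 2 * fib m"
    using fib_mult_le_twice_fib[of "p + 1" "r + 1"] by (simp add: p r numeral_eq_Suc ac_simps del: fib.simps)
  finally show ?thesis by simp
qed

section \<open>Arcs of the circle and interiors on the torus\<close>

lemma cis_2pi_eq_iff: "cis (2 * pi * x) = cis (2 * pi * y) \<longleftrightarrow> x - y \<in> \<int>"
proof -
  have "cis (2 * pi * x) = cis (2 * pi * y) \<longleftrightarrow> (\<exists>n::int. 2 * pi * x = 2 * pi * y + 2 * pi * n)"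
    using sin_cos_eq_iff[of "2 * pi * x" "2 * pi * y"] by (auto simp: complex_eq_iff)
  also have "\<dots> \<longleftrightarrow> (\<exists>n::int. x - y = n)"
    by (simp flip: distrib_left add: diff_eq_eq add.commute)
  finally show ?thesis by (auto simp: Ints_def)
qed

lemma circle_eq_cis_2pi:
  assumes "z \<in> sphere 0 1"
  obtains x where "a \<le> x" "x < a + 1" "z = cis (2 * pi * x)"
proof -
  obtain u where u: "z = cis u"
    using assms complex_unimodular_polar[of z] by (auto simp: complex_eq_iff)
  define x where "x = a + frac (u / (2 * pi) - a)"
  have "cis (2 * pi * (u / (2 * pi))) = cis (2 * pi * x)"
    unfolding cis_2pi_eq_iff by (simp add: x_def frac_def)
  then show ?thesis
    using that[of x] frac_lt_1[of "u / (2 * pi) - a"] by (simp add: x_def u)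
qed

definition periodic_length :: "real \<Rightarrow> real \<Rightarrow> real" where
  "periodic_length a b = (if a \<le> b then b - a else 1 - a + b)"

lemma periodic_length_bounds:
  "a \<in> {0..1} \<Longrightarrow> b \<in> {0..1} \<Longrightarrow> 0 \<le> periodic_length a b \<and> periodic_length a b \<le> 1"
  by (auto simp: periodic_length_def)

text \<open>
  The arc is realised as the complement of a compact arc, which avoids a separate treatment
  of the full circle and of the degenerate interval.
\<close>
lemma open_arc:
  assumes ab: "a \<in> {0..1}" "b \<in> {0..1}"
  obtains U where "openin (top_of_set (sphere 0 1)) U"
    "U \<subseteq> (\<lambda>x. cis (2 * pi * x)) ` periodic_interval a b"
    "\<And>x. a < x \<Longrightarrow> x < a + periodic_length a b \<Longrightarrow> cis (2 * pi * x) \<in> U"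
proof
  define l where "l = periodic_length a b"
  have l: "0 \<le> l" "l \<le> 1"
    using periodic_length_bounds[OF ab] by (auto simp: l_def)
  \<comment> \<open>The complementary arc: the whole circle for \<open>l = 0\<close>, a single point
    for \<open>l = 1\<close>.\<close>
  define K where "K = (\<lambda>x. cis (2 * pi * x)) ` {a + l..a + 1}"
  have "compact K"
    unfolding K_def by (intro compact_continuous_image continuous_intros compact_Icc)
  then show "openin (top_of_set (sphere 0 1)) (sphere 0 1 - K)"
    by (auto simp: openin_open Diff_eq intro!: exI[of _ "- K"] compact_imp_closed open_Compl)
  show "sphere 0 1 - K \<subseteq> (\<lambda>x. cis (2 * pi * x)) ` periodic_interval a b"
  proof
    fix z assume z: "z \<in> sphere 0 1 - K"
    then obtain x where x: "a \<le> x" "x < a + 1" "z = cis (2 * pi * x)"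
      using circle_eq_cis_2pi[of z a] by auto
    with z have xl: "x < a + l"
      by (force simp: K_def)
    show "z \<in> (\<lambda>x. cis (2 * pi * x)) ` periodic_interval a b"
    \<comment> \<open>A parameter beyond 1 occurs only for wrapped intervals and is taken back by
      one full turn.\<close>
    proof (cases "a \<le> b \<or> x \<le> 1")
      case True
      then have "x \<in> periodic_interval a b"
        using x xl by (auto simp: periodic_interval_def l_def periodic_length_def)
      then show ?thesis using x by blast
    next
      case False
      then have "x - 1 \<in> periodic_interval a b"
        using xl by (auto simp: periodic_interval_def l_def periodic_length_def)
      moreover have "z = cis (2 * pi * (x - 1))"
        unfolding x cis_2pi_eq_iff by simp
      ultimately show ?thesis by blast
    qed
  qed
  show "cis (2 * pi * x) \<in> sphere 0 1 - K" if "a < x" "x < a + periodic_length a b" for x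
  proof -
    have "cis (2 * pi * x) \<noteq> cis (2 * pi * y)" if "y \<in> {a + l..a + 1}" for y
    proof
      assume "cis (2 * pi * x) = cis (2 * pi * y)"
      then obtain k :: int where "x - y = k"
        unfolding cis_2pi_eq_iff by (auto elim: Ints_cases)
      moreover have "- 1 < x - y" "x - y < 0"
        using \<open>y \<in> _\<close> \<open>a < x\<close> \<open>x < _\<close> by (auto simp: l_def)
      ultimately have "- 1 < k" "k < 0" by linarith+
      then show False by simp
    qed
    then have "cis (2 * pi * x) \<notin> K"
      unfolding K_def by blast
    then show ?thesis by simp
  qed
qed

text \<open>A product of two open arcs fits between the point and the rectangle. As \<open>u\<close>
  and \<open>v\<close> may exceed 1, wrapped rectangles can be treated as ordinary boxes in the
  plane.\<close>

lemma torus_interior_of_rectangle: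
  assumes "x \<in> unit_square" "y \<in> unit_square"
    and "fst x < u" "u < fst x + periodic_length (fst x) (fst y)"
    and "snd x < v" "v < snd x + periodic_length (snd x) (snd y)"
  shows "to_torus (u, v) \<in> torus interior_of (to_torus ` periodic_rectangle x y)"
proof -
  have *: "fst x \<in> {0..1}" "fst y \<in> {0..1}" "snd x \<in> {0..1}" "snd y \<in> {0..1}"
    using assms(1,2) by (auto simp: unit_square_def mem_Times_iff)
  obtain U where U: "openin (top_of_set (sphere 0 1)) U"
    "U \<subseteq> (\<lambda>x. cis (2 * pi * x)) ` periodic_interval (fst x) (fst y)" "cis (2 * pi * u) \<in> U"
    using open_arc[OF *(1,2)] assms(3,4) by metis
  obtain V where V: "openin (top_of_set (sphere 0 1)) V"
    "V \<subseteq> (\<lambda>x. cis (2 * pi * x)) ` periodic_interval (snd x) (snd y)" "cis (2 * pi * v) \<in> V"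
    using open_arc[OF *(3,4)] assms(5,6) by metis
  have "U \<times> V \<subseteq> to_torus ` periodic_rectangle x y"
    using U(2) V(2) by (fastforce simp: to_torus_def periodic_rectangle_def image_iff)
  moreover have "openin torus (U \<times> V)"
    unfolding torus_def using U(1) V(1) by (rule openin_Times)
  ultimately have "U \<times> V \<subseteq> torus interior_of (to_torus ` periodic_rectangle x y)"
    by (rule interior_of_maximal)
  then show ?thesis
    using U(3) V(3) by (auto simp: to_torus_def)
qed

lemma emeasure_periodic_interval:
  assumes "a \<in> {0..1}" "b \<in> {0..1}"
  shows "emeasure lborel (periodic_interval a b) = ennreal (periodic_length a b)"
proof (cases "a \<le> b")
  case True
  then show ?thesis by (simp add: periodic_interval_def periodic_length_def)
next
  case False
  then have "emeasure lborel ({0..b} \<union> {a..1}) = emeasure lborel {0..b} + emeasure lborel {a..1}"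
    by (intro plus_emeasure[symmetric]) auto
  then show ?thesis
    using False assms
    by (simp add: periodic_interval_def periodic_length_def ennreal_plus[symmetric] add.commute
        del: ennreal_plus)
qed

lemma measure_periodic_rectangle:
  assumes "x \<in> unit_square" "y \<in> unit_square"
  shows "measure lborel (periodic_rectangle x y) =
    periodic_length (fst x) (fst y) * periodic_length (snd x) (snd y)"
proof -
  have *: "fst x \<in> {0..1}" "fst y \<in> {0..1}" "snd x \<in> {0..1}" "snd y \<in> {0..1}"
    using assms by (auto simp: unit_square_def mem_Times_iff)
  have "emeasure lborel (periodic_rectangle x y) =
    ennreal (periodic_length (fst x) (fst y)) * ennreal (periodic_length (snd x) (snd y))"
    unfolding periodic_rectangle_def lborel_prod[symmetric]
    using * by (subst lborel.emeasure_pair_measure_Times)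
      (auto simp: emeasure_periodic_interval, simp_all add: periodic_interval_def)
  then show ?thesis
    using periodic_length_bounds[OF *(1,2)] periodic_length_bounds[OF *(3,4)]
    by (simp add: measure_def ennreal_mult[symmetric])
qed

section \<open>Upper bound for empty periodic rectangles\<close>

text \<open>Reducing \<open>i\<close> modulo \<open>fib m\<close> gives the index \<open>k\<close>
  of a point of the set whose coordinates differ from the given ones by integers.\<close>

lemma to_torus_integer_lattice:
  assumes m: "m > 0" and ij: "(i, j) \<in> integer_lattice (fib m) (fib (m - 2))"
  shows "to_torus (of_int i / fib m, of_int j / fib m) \<in> to_torus ` fibonacci_lattice m"
proof -
  define n q where "n = fib m" and "q = fib (m - 2)"
  have n: "n > 0" using m by (simp add: n_def fib_neq_0_nat)
  define k where "k = nat (i mod n)"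
  have k: "int k = i mod n" "k \<in> {0..n - 1}"
    using n by (auto simp: k_def nat_le_iff)
  obtain e :: int where e: "j - i * q = n * e"
    using ij by (auto simp: integer_lattice_def n_def q_def elim: dvdE)
  have i: "i = n * (i div n) + k"
    using k(1) by simp
  have "of_int i / real n - k / n = of_int (i div n)"
    using n by (subst (1) i) (simp add: field_simps)
  then have "of_int i / real n - k / n \<in> \<int>"
    by simp
  moreover have "of_int j / real n - frac (real (k * q) / n) \<in> \<int>"
  proof -
    have j: "j = n * e + (n * (i div n) + k) * q"
      using e i by simp
    have "of_int j / real n - real (k * q) / n = of_int (e + i div n * q)"
      using n by (subst j) (simp add: field_simps)
    then have "of_int j / real n - frac (real (k * q) / n) =
        of_int (e + i div n * q + \<lfloor>real (k * q) / n\<rfloor>)"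
      by (simp add: frac_def)
    then show ?thesis by (metis Ints_of_int)
  qed
  ultimately have "to_torus (of_int i / n, of_int j / n) =
      to_torus (k / n, frac (real (k * q) / n))"
    unfolding to_torus_def fst_conv snd_conv prod.inject cis_2pi_eq_iff by blast
  then show ?thesis
    using k(2) unfolding fibonacci_lattice_def n_def q_def image_image by (rule image_eqI)
qed

text \<open>Scaling by \<open>n\<close> turns the rectangle into an empty box of area at most
  \<open>2 * n\<close>; dividing by the square of \<open>n\<close> gives the bound.\<close>

lemma empty_rectangle_area_le:
  assumes m: "m \<ge> 3" and xy: "x \<in> unit_square" "y \<in> unit_square"
    and empty: "empty_rectangle (fibonacci_lattice m) (periodic_rectangle x y)"
  shows "measure lborel (periodic_rectangle x y) \<le> 2 / fib m"
proof -
  define n where "n = real (fib m)"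
  have n: "n > 0" using m by (simp add: n_def fib_neq_0_nat)
  define s t where "s = periodic_length (fst x) (fst y)" and "t = periodic_length (snd x) (snd y)"
  have st: "0 \<le> s" "s \<le> 1" "0 \<le> t" "t \<le> 1"
    using xy periodic_length_bounds by (auto simp: s_def t_def unit_square_def mem_Times_iff)
  have "(n * s) * (n * t) \<le> 2 * n"
    unfolding n_def
  proof (rule empty_box_area_le[OF m, where X = "n * fst x" and Y = "n * snd x"],
      fold n_def)
    fix i j
    assume ij: "(i, j) \<in> integer_lattice (fib m) (fib (m - 2))"
      and "n * fst x < of_int i" "of_int i < n * fst x + n * s"
        "n * snd x < of_int j" "of_int j < n * snd x + n * t"
    then have "to_torus (of_int i / n, of_int j / n) \<in>
        torus interior_of (to_torus ` periodic_rectangle x y)"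
      using n by (intro torus_interior_of_rectangle xy) (auto simp: field_simps s_def t_def)
    then show False
      using to_torus_integer_lattice[OF _ ij] m empty
      by (auto simp: empty_rectangle_def n_def)
  qed (use st n in auto)
  then have "s * t \<le> 2 / n"
    using n by (simp add: field_simps)
  then show ?thesis
    by (simp add: measure_periodic_rectangle xy s_def t_def n_def)
qed

section \<open>Lower bound by nearly extremal rectangles\<close>

lemma coprime_fib_diff_2:
  assumes "m \<ge> 2"
  shows "coprime (fib m) (fib (m - 2))"
proof -
  have "gcd (fib (m - 2)) (fib m) = gcd (fib 2) (fib m)"
    using assms gcd_diff2_nat[of "m - 2" m] by (simp only: fib_gcd[symmetric]) simp
  then show ?thesis by (simp add: coprime_iff_gcd_eq_1 gcd.commute)
qed

text \<open>
  The rectangles avoid the only lattice point on the horizontal line through the origin, namely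
  the origin itself. They are shrunk by \<open>e\<close> on each side so that already the closed rectangle
  contains no lattice point; the extremal area is approached but need not be attained.
\<close>
lemma large_empty_rectangle:
  assumes m: "m \<ge> 3" and e: "0 < e" "e < 1 / fib m"
  defines "x \<equiv> (e, 1 - 1 / fib m + e)" and "y \<equiv> (1 - e, 1 / fib m - e)"
  shows "x \<in> unit_square" "y \<in> unit_square"
    and "measure lborel (periodic_rectangle x y) = (1 - 2 * e) * (2 / fib m - 2 * e)"
    and "empty_rectangle (fibonacci_lattice m) (periodic_rectangle x y)"
proof -
  define n where "n = fib m"
  have "fib 3 = 2" by (simp add: eval_nat_numeral)
  \<comment> \<open>With \<open>n \<ge> 2\<close>, the second interval wraps around and the first
    does not.\<close>
  then have n: "n \<ge> 2" using fib_mono[OF m] by (simp add: n_def)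
  then have n2: "1 / real n \<le> 1 / 2" by (simp add: field_simps)
  have e': "e < 1 / n" using e by (simp add: n_def)
  have x: "x = (e, 1 - 1 / n + e)" and y: "y = (1 - e, 1 / n - e)"
    by (simp_all add: x_def y_def n_def)
  show xy: "x \<in> unit_square" "y \<in> unit_square"
    using e e' n2 by (auto simp: x y unit_square_def)
  show "measure lborel (periodic_rectangle x y) = (1 - 2 * e) * (2 / fib m - 2 * e)"
    using e e' n2 unfolding measure_periodic_rectangle[OF xy] n_def[symmetric]
    by (simp add: x y periodic_length_def)
  have False if k: "k \<in> {0..n - 1}"
    and uv: "(u, v) \<in> periodic_rectangle x y"
    and eq: "to_torus (u, v) = to_torus (k / n, frac (real (k * fib (m - 2)) / n))" for k u v
  proof -
    have u: "e \<le> u" "u \<le> 1 - e" and v: "0 \<le> v" "v \<le> 1" "v < 1 / n \<or> 1 - 1 / n < v"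
      using uv e e' n2 by (auto simp: x y periodic_rectangle_def periodic_interval_def split: if_splits)
    have "frac (real (k * fib (m - 2)) / n) - v \<in> \<int>" and ku: "k / n - u \<in> \<int>"
      using eq[symmetric] unfolding to_torus_def prod.inject fst_conv snd_conv cis_2pi_eq_iff by blast+
    then have "\<lfloor>real (k * fib (m - 2)) / n\<rfloor> + (frac (real (k * fib (m - 2)) / n) - v) \<in> \<int>"
      by (intro Ints_add) auto
    then have "real (k * fib (m - 2)) / n - v \<in> \<int>"
      by (simp add: frac_def)
    then obtain w :: int where w: "real (k * fib (m - 2)) / n - v = w"
      by (auto elim: Ints_cases)
    \<comment> \<open>In units of \<open>1 / n\<close> the height \<open>v\<close> is an integer
      \<open>l\<close> from 0 to \<open>n\<close> at distance less than 1 from an end, so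
      \<open>n\<close> divides \<open>l\<close>. Coprimality then forces \<open>k = 0\<close>, which
      makes \<open>u\<close> an integer although \<open>0 < u < 1\<close>.\<close>
    define l where "l = int (k * fib (m - 2)) - w * n"
    have vl: "v * n = l"
      using w n by (simp add: l_def field_simps)
    have "l < 1 \<or> n - 1 < l"
    proof -
      have "v * n < 1 \<or> n - 1 < v * n"
        using v(3) n by (auto simp: field_simps)
      then show ?thesis unfolding vl using n by linarith
    qed
    moreover have "0 \<le> v * n" "v * n \<le> n"
      using v n by (auto simp: mult_le_cancel_right1)
    then have "0 \<le> l" "l \<le> n"
      unfolding vl by linarith+
    ultimately have "l = 0 \<or> l = n" by linarith
    then have "int n dvd l + w * n"
      by auto
    then have "int n dvd int (k * fib (m - 2))"
      by (simp add: l_def)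
    then have "n dvd k * fib (m - 2)"
      by (simp only: of_nat_dvd_iff)
    moreover have "coprime n (fib (m - 2))"
      using coprime_fib_diff_2[of m] m by (simp add: n_def)
    ultimately have "n dvd k"
      by (simp add: coprime_dvd_mult_left_iff)
    then have "k = 0"
      using k n by (auto dest: dvd_imp_le)
    then obtain w' :: int where "u = w'"
      using ku by (auto elim: Ints_cases)
    moreover have "0 < u" "u < 1" using u e by auto
    ultimately show False by simp
  qed
  then have "to_torus r \<noteq> to_torus (k / n, frac (real (k * fib (m - 2)) / n))"
    if "k \<in> {0..n - 1}" "r \<in> periodic_rectangle x y" for k r
    using that by (cases r) blast
  then have "to_torus ` fibonacci_lattice m \<inter> to_torus ` periodic_rectangle x y = {}"
    unfolding fibonacci_lattice_def n_def[symmetric] image_image disjoint_iff image_iff by metis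
  then show "empty_rectangle (fibonacci_lattice m) (periodic_rectangle x y)"
    unfolding empty_rectangle_def
    using interior_of_subset[of torus "to_torus ` periodic_rectangle x y"] by blast
qed

theorem theorem2:
  fixes m :: nat
  assumes "m \<ge> 3"
  shows "disp (fibonacci_lattice m) = 2 / real (fib m)"
proof (rule antisym)
  let ?A = "{measure lborel (periodic_rectangle x y) | x y.
     x \<in> unit_square \<and> y \<in> unit_square \<and>
     empty_rectangle (fibonacci_lattice m) (periodic_rectangle x y)}"
  have n: "0 < 1 / real (fib m)"
    using assms by (simp add: fib_neq_0_nat)
  have le: "a \<le> 2 / fib m" if "a \<in> ?A" for a
    using that empty_rectangle_area_le[OF assms] by blast
  have mem: "(1 - 2 * e) * (2 / fib m - 2 * e) \<in> ?A" if "0 < e" "e < 1 / fib m" for e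
    using large_empty_rectangle[OF assms that] by (smt (verit) mem_Collect_eq)
  obtain e where "0 < e" "e < 1 / fib m"
    using dense[OF n] by blast
  then have "?A \<noteq> {}" using mem by blast
  then show "disp (fibonacci_lattice m) \<le> 2 / fib m"
    unfolding disp_def by (rule cSup_least) (rule le)
  \<comment> \<open>The supremum dominates every shrunken area, hence also their limit as
    \<open>e\<close> tends to 0 from the right.\<close>
  have "((\<lambda>e. (1 - 2 * e) * (2 / fib m - 2 * e)) \<longlongrightarrow> (1 - 2 * 0) * (2 / fib m - 2 * 0)) (at_right 0)"
    by (intro tendsto_intros)
  moreover have "bdd_above ?A"
    using le by (rule bdd_aboveI)
  then have "eventually (\<lambda>e. (1 - 2 * e) * (2 / fib m - 2 * e) \<le> disp (fibonacci_lattice m)) (at_right 0)"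
    unfolding disp_def eventually_at_right_field
    using mem n by (intro exI[of _ "1 / real (fib m)"]) (simp add: cSup_upper)
  ultimately show "2 / fib m \<le> disp (fibonacci_lattice m)"
    using tendsto_upperbound[of _ _ "at_right (0::real)"] by force
qed

end
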